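(* For every $n\ge5$, $$|\mathcal{RS}_n(123,231)|=|\mathcal{RS}_n(123,312)|=0.$$
   Context: $\mathfrak{S}_n$ is the set of permutations of $\{1,\dots,n\}$, written in one-line notation $\pi=\pi_1\pi_2\dots\pi_n$. A permutation $\pi\in\mathfrak{S}_n$ is simsun if for every $3\le k\le n$, the subword of $\pi_1\pi_2\dots\pi_n$ consisting of the entries in $\{1,\dots,k\}$ (kept in their order) has no double descent, i.e. no three entries that are consecutive in that subword and in decreasing order. A permutation $\pi\in\mathfrak{S}_n$ avoids the pattern $\sigma\in\mathfrak{S}_k$ if there are no indices $i_1<i_2<\dots<i_k$ such that $\pi_{i_1}\pi_{i_2}\dots\pi_{i_k}$ is in the same relative order as $\sigma$. $\mathcal{RS}_n(\sigma,\tau)$ is the set of simsun permutations in $\mathfrak{S}_n$ avoiding both $\sigma$ and $\tau$. *)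

theory Defs
  imports "HOL-Combinatorics.Multiset_Permutations"
begin

text \<open>
  A permutation of \<open>{1..n}\<close> is represented by its one-line notation, that is, by an element of
  \<^term>\<open>permutations_of_set {1..n::nat}\<close>. List positions are counted from 0, entries from 1.
\<close>

definition has_double_descent :: "nat list \<Rightarrow> bool" where
  "has_double_descent w \<longleftrightarrow>
    (\<exists>i. i + 2 < length w \<and> w ! i > w ! (i + 1) \<and> w ! (i + 1) > w ! (i + 2))"

definition simsun :: "nat list \<Rightarrow> bool" where
  "simsun \<pi> \<longleftrightarrow>
    (\<forall>k. 3 \<le> k \<and> k \<le> length \<pi> \<longrightarrow> \<not> has_double_descent (filter (\<lambda>x. x \<in> {1..k}) \<pi>))"

definition same_relative_order :: "nat list \<Rightarrow> nat list \<Rightarrow> bool" where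
  "same_relative_order xs ys \<longleftrightarrow> length xs = length ys \<and>
    (\<forall>i<length xs. \<forall>j<length xs. xs ! i < xs ! j \<longleftrightarrow> ys ! i < ys ! j)"

definition avoids :: "nat list \<Rightarrow> nat list \<Rightarrow> bool" where
  "avoids \<pi> \<sigma> \<longleftrightarrow>
    \<not> (\<exists>f. strict_mono_on {..<length \<sigma>} f \<and> (\<forall>i<length \<sigma>. f i < length \<pi>) \<and>
           same_relative_order (map (\<lambda>i. \<pi> ! f i) [0..<length \<sigma>]) \<sigma>)"

definition RS :: "nat \<Rightarrow> nat list \<Rightarrow> nat list \<Rightarrow> nat list set" where
  "RS n \<sigma> \<tau> = {\<pi> \<in> permutations_of_set {1..n}. simsun \<pi> \<and> avoids \<pi> \<sigma> \<and> avoids \<pi> \<tau>}"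

text \<open>Cardinality 0 therefore means emptiness.\<close>

lemma finite_RS: "finite (RS n \<sigma> \<tau>)"
  by (simp add: RS_def)

end

theory Submission
  imports Defs
begin

text \<open>
  Under either pair of avoidance conditions, the absence of double descents in \<open>\<pi>\<close> itself, which is
  simsunness at \<open>k = n\<close>, already bounds the length by 4. Split a word with distinct entries at its minimum. A word avoiding 123 decreases
  after the minimum, since an ascent there would complete a 123; a word avoiding 231 decreases
  before the minimum, since an ascent there followed by the minimum is a 231. Without double
  descents, the entries up to and including the minimum are at most two and those after it are also
  at most two.

  For 123 and 312 the same argument applies with the maximum in place of the minimum: the
  reverse-complement symmetry exchanges 231 with 312, fixes 123, and preserves double descents.
\<close>

lemma avoids_length_3D:
  assumes "avoids w \<sigma>" "length \<sigma> = 3" "i < j" "j < k" "k < length w"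
  shows "\<not> same_relative_order [w ! i, w ! j, w ! k] \<sigma>"
proof
  assume "same_relative_order [w ! i, w ! j, w ! k] \<sigma>"
  moreover have "map (\<lambda>t. w ! ([i, j, k] ! t)) [0..<length \<sigma>] = [w ! i, w ! j, w ! k]"
    using assms(2) by (simp add: upt_rec)
  moreover have "strict_mono_on {..<length \<sigma>} (\<lambda>t. [i, j, k] ! t)"
    using assms by (auto simp: strict_mono_on_def nth_Cons' numeral_3_eq_3 less_Suc_eq)
  moreover have "\<forall>t<length \<sigma>. [i, j, k] ! t < length w"
    using assms by (auto simp: nth_Cons' numeral_3_eq_3 less_Suc_eq)
  ultimately show False
    using assms(1) by (auto simp: avoids_def)
qed

lemma same_relative_order_length_3:
  "same_relative_order [a, b, c] [1, 2, 3] \<longleftrightarrow> a < b \<and> b < c"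
  "same_relative_order [a, b, c] [2, 3, 1] \<longleftrightarrow> c < a \<and> a < b"
  "same_relative_order [a, b, c] [3, 1, 2] \<longleftrightarrow> b < c \<and> c < a"
  by (auto simp: same_relative_order_def numeral_3_eq_3 less_Suc_eq)

lemmas avoids_123D = avoids_length_3D[of _ "[1, 2, 3]", simplified same_relative_order_length_3]
lemmas avoids_231D = avoids_length_3D[of _ "[2, 3, 1]", simplified same_relative_order_length_3]
lemmas avoids_312D = avoids_length_3D[of _ "[3, 1, 2]", simplified same_relative_order_length_3]

lemma has_double_descentI:
  assumes "i + 2 < length w" "w ! (i + 1) < w ! i" "w ! (i + 2) < w ! (i + 1)"
  shows "has_double_descent w"
  using assms unfolding has_double_descent_def by blast

text \<open>
  The case distinction is on the position of the minimum: if two entries precede it, the three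
  entries ending in it decrease by 231-avoidance; otherwise at least three entries follow it, and
  they decrease by 123-avoidance.
\<close>

lemma double_descent_if_avoids_123_231:
  assumes "distinct w" "5 \<le> length w" "avoids w [1, 2, 3]" "avoids w [2, 3, 1]"
  shows "has_double_descent w"
proof -
  have "Min (set w) \<in> set w"
    using assms(2) by (intro Min_in) auto
  then obtain p where p: "p < length w" "w ! p = Min (set w)"
    by (auto simp: in_set_conv_nth)
  have min: "w ! p < w ! i" if "i < length w" "i \<noteq> p" for i
  proof -
    have "w ! p \<le> w ! i" using p that by simp
    moreover have "w ! p \<noteq> w ! i"
      using nth_eq_iff_index_eq[OF assms(1)] p(1) that by metis
    ultimately show ?thesis by simp
  qed
  have distinct_nth: "w ! i \<noteq> w ! j" if "i < j" "j < length w" for i j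
    using that assms(1) by (simp add: nth_eq_iff_index_eq)
  show ?thesis
  proof (cases "2 \<le> p")
    case True
    then obtain q where q: "p = q + 2" by (metis le_add_diff_inverse2)
    have "\<not> (w ! p < w ! q \<and> w ! q < w ! (q + 1))"
      using avoids_231D[OF assms(4), of q "q + 1" p] p q by simp
    then have "w ! (q + 1) < w ! q"
      using min[of q] distinct_nth[of q "q + 1"] p q by auto
    then show ?thesis
      using min[of "q + 1"] p q by (intro has_double_descentI[of q]) auto
  next
    case False
    have desc: "w ! j < w ! i" if "p < i" "i < j" "j < length w" for i j
      using avoids_123D[OF assms(3), of p i j] min[of i] distinct_nth[of i j] that by auto
    show ?thesis
      using desc[of "p + 1" "p + 2"] desc[of "p + 2" "p + 3"] False assms(2)
      by (intro has_double_descentI[of "p + 1"]) (auto simp: numeral_eq_Suc)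
  qed
qed

text \<open>
  If two entries follow the maximum, the three entries starting with it decrease by 312-avoidance;
  otherwise at least three entries precede it, and they decrease by 123-avoidance.
\<close>

lemma double_descent_if_avoids_123_312:
  assumes "distinct w" "5 \<le> length w" "avoids w [1, 2, 3]" "avoids w [3, 1, 2]"
  shows "has_double_descent w"
proof -
  have "Max (set w) \<in> set w"
    using assms(2) by (intro Max_in) auto
  then obtain p where p: "p < length w" "w ! p = Max (set w)"
    by (auto simp: in_set_conv_nth)
  have max: "w ! i < w ! p" if "i < length w" "i \<noteq> p" for i
  proof -
    have "w ! i \<le> w ! p" using p that by simp
    moreover have "w ! i \<noteq> w ! p"
      using nth_eq_iff_index_eq[OF assms(1)] p(1) that by metis
    ultimately show ?thesis by simp
  qed
  have distinct_nth: "w ! i \<noteq> w ! j" if "i < j" "j < length w" for i j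
    using that assms(1) by (simp add: nth_eq_iff_index_eq)
  show ?thesis
  proof (cases "p + 2 < length w")
    case True
    have "\<not> (w ! (p + 1) < w ! (p + 2) \<and> w ! (p + 2) < w ! p)"
      using avoids_312D[OF assms(4), of p "p + 1" "p + 2"] True by simp
    then have "w ! (p + 2) < w ! (p + 1)"
      using max[of "p + 2"] distinct_nth[of "p + 1" "p + 2"] True by auto
    then show ?thesis
      using max[of "p + 1"] True by (intro has_double_descentI[of p]) auto
  next
    case False
    with assms(2) have "3 \<le> p" by simp
    then obtain q where q: "p = q + 3" by (metis le_add_diff_inverse2)
    have desc: "w ! j < w ! i" if "i < j" "j < p" for i j
      using avoids_123D[OF assms(3), of i j p] max[of j] distinct_nth[of i j] that p by auto
    show ?thesis
      using desc[of q "q + 1"] desc[of "q + 1" "q + 2"] p q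
      by (intro has_double_descentI[of q]) auto
  qed
qed

lemma simsun_permutation_no_double_descent:
  assumes "\<pi> \<in> permutations_of_set {1..n}" "simsun \<pi>" "3 \<le> n"
  shows "\<not> has_double_descent \<pi>"
proof -
  have "set \<pi> = {1..n}" "length \<pi> = n"
    using assms(1) length_finite_permutations_of_set[OF assms(1)]
    by (auto simp: permutations_of_set_def)
  moreover from this have "filter (\<lambda>x. x \<in> {1..n}) \<pi> = \<pi>"
    by (intro filter_True) auto
  ultimately show ?thesis
    using assms(2,3) unfolding simsun_def by (metis order_refl)
qed

theorem lemma7p3:
  fixes n :: nat
  assumes "n \<ge> 5"
  shows "card (RS n [1, 2, 3] [2, 3, 1]) = 0 \<and> card (RS n [1, 2, 3] [3, 1, 2]) = 0"
proof -
  have "distinct \<pi> \<and> 5 \<le> length \<pi> \<and> \<not> has_double_descent \<pi>"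
    if "\<pi> \<in> permutations_of_set {1..n}" "simsun \<pi>" for \<pi>
    using that assms simsun_permutation_no_double_descent[OF that]
      length_finite_permutations_of_set[OF that(1)]
    by (auto simp: permutations_of_set_def)
  then have "RS n [1, 2, 3] [2, 3, 1] = {}" "RS n [1, 2, 3] [3, 1, 2] = {}"
    using double_descent_if_avoids_123_231 double_descent_if_avoids_123_312
    unfolding RS_def by blast+
  then show ?thesis by simp
qed

end
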